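(* Let $w=w(x_1,\ldots,x_r)$ be a lower central word (i.e. $w=\gamma_r$ for some $r\ge 1$) or a derived word (i.e. $w=\delta_k$ for some $k\ge 0$, with $r=2^k$). Let $\mathbf{N}=(N_1,\ldots,N_r)$ be a tuple of normal subgroups of a group $G$ such that the set $w\{\mathbf{N}\}$ is finite. Then the subgroup $w(\mathbf{N})$ is also finite.
   Context: For a word $w=w(x_1,\ldots,x_r)$ and a tuple $\mathbf{S}=(S_1,\ldots,S_r)$ of subsets of a group $G$, $w\{\mathbf{S}\}=\{w(g_1,\ldots,g_r)\mid g_i\in S_i\}$ and $w(\mathbf{S})=\langle w\{\mathbf{S}\}\rangle$. Commutators are $[x,y]=x^{-1}y^{-1}xy$, and longer commutators are left-normed: $[x_1,\ldots,x_r]=[[x_1,\ldots,x_{r-1}],x_r]$. The lower central words are $\gamma_r(x_1,\ldots,x_r)=[x_1,\ldots,x_r]$ (with $\gamma_1=x_1$). The derived words are defined by $\delta_0=x_1$ and $\delta_k(x_1,\ldots,x_{2^k})=[\delta_{k-1}(x_1,\ldots,x_{2^{k-1}}),\delta_{k-1}(x_{2^{k-1}+1},\ldots,x_{2^k})]$. *)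

theory Defs
  imports "HOL-Algebra.Algebra"
begin

text \<open>Words are group terms over variables of type \<^typ>\<open>'x\<close>, not reduced elements of a free group;
  only their values under assignments of group elements to the variables are used.\<close>

datatype 'x gword =
    GVar 'x
  | GOne
  | GMult "'x gword" "'x gword"
  | GInv "'x gword"

primrec gword_eval :: "('a, 'b) monoid_scheme \<Rightarrow> ('x \<Rightarrow> 'a) \<Rightarrow> 'x gword \<Rightarrow> 'a" where
  "gword_eval G g (GVar i) = g i"
| "gword_eval G g GOne = \<one>\<^bsub>G\<^esub>"
| "gword_eval G g (GMult u v) = gword_eval G g u \<otimes>\<^bsub>G\<^esub> gword_eval G g v"
| "gword_eval G g (GInv u) = inv\<^bsub>G\<^esub> (gword_eval G g u)"

text \<open>The convention is $[x,y] = x^{-1} y^{-1} x y$, unlike the one behind \<^const>\<open>derived_set\<close>.\<close>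

definition gcomm :: "'x gword \<Rightarrow> 'x gword \<Rightarrow> 'x gword" where
  "gcomm u v = GMult (GMult (GMult (GInv u) (GInv v)) u) v"

text \<open>The variables of an $r$-variable word are numbered $1, \ldots, r$.
  The value of \<open>lower_central_word\<close> at \<open>0\<close> is a dummy.\<close>

fun lower_central_word :: "nat \<Rightarrow> nat gword" where
  "lower_central_word 0 = GOne"
| "lower_central_word (Suc 0) = GVar 1"
| "lower_central_word (Suc (Suc n)) = gcomm (lower_central_word (Suc n)) (GVar (Suc (Suc n)))"

primrec derived_word :: "nat \<Rightarrow> nat gword" where
  "derived_word 0 = GVar 1"
| "derived_word (Suc k) = gcomm (derived_word k) (map_gword (\<lambda>i. 2 ^ k + i) (derived_word k))"

lemma set_lower_central_word: "set_gword (lower_central_word r) = {1..r}"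
  by (induction r rule: lower_central_word.induct) (auto simp: gcomm_def)

lemma set_derived_word: "set_gword (derived_word k) = {1..2 ^ k}"
proof (induction k)
  case 0
  show ?case by simp
next
  case (Suc k)
  have "(\<lambda>i. 2 ^ k + i) ` {1..2 ^ k} = {1 + 2 ^ k..2 ^ k + 2 ^ k :: nat}"
    by (rule image_add_atLeastAtMost)
  moreover have "{1..m} \<union> {1 + m..m + m} = {1..m + m}" for m :: nat
    by auto
  ultimately show ?case
    by (simp only: derived_word.simps gcomm_def gword.set gword.set_map Suc power_Suc mult_2) auto
qed

text \<open>For an $r$-variable word $w$: the set $w\{\mathbf{S}\}$ of values and the subgroup $w(\mathbf{S})$.
  Only the entries \<open>S 1, \<dots>, S r\<close> of the tuple are relevant.\<close>

definition word_values ::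
    "('a, 'b) monoid_scheme \<Rightarrow> nat \<Rightarrow> nat gword \<Rightarrow> (nat \<Rightarrow> 'a set) \<Rightarrow> 'a set" where
  "word_values G r w S = {gword_eval G g w | g. \<forall>i\<in>{1..r}. g i \<in> S i}"

definition word_subgroup ::
    "('a, 'b) monoid_scheme \<Rightarrow> nat \<Rightarrow> nat gword \<Rightarrow> (nat \<Rightarrow> 'a set) \<Rightarrow> 'a set" where
  "word_subgroup G r w S = generate G (word_values G r w S)"

end

theory Submission
  imports Defs
begin

text \<open>Both kinds of words are outer commutator words, i.e. binary trees of commutators whose
  leaves are distinct variables; the argument works for every such word. Let \<open>W\<close> be the subgroup
  generated by the finite normal set of values. By Schur's theorem its derived subgroup is finite, and
  by Dietzmann's lemma it then suffices that every value is torsion modulo it, i.e. that every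
  homomorphism from \<open>W\<close> to a torsion-free abelian group is trivial.

  This is shown by descending the tree. At a node with children \<open>l\<close> and \<open>r\<close> and subgroups
  $A = [A_l, A_r]$ one has a homomorphism $f$ on $A$. If $f$ kills $[A, A_l]$, then
  $a \mapsto f([a, y])$ is a homomorphism on $A_l$ for each $y \in A_r$, and similarly on the other
  side. At a leaf $N$ the homomorphism has finite image, because powers of elements of $N$ stay
  in $N$, so it is trivial.\<close>

section \<open>Commutators and products of bounded length\<close>

context group
begin

text \<open>Together with \<open>m_assoc\<close> and \<open>inv_mult_group\<close> this cancels
  adjacent inverse factors in right-nested products, so that the commutator identities below are
  settled by \<open>simp\<close>.\<close>

lemma mult_inv_cancel [simp]:
  assumes "x \<in> carrier G" "y \<in> carrier G"
  shows "x \<otimes> (inv x \<otimes> y) = y" "inv x \<otimes> (x \<otimes> y) = y"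
  using assms by (simp_all flip: m_assoc)

text \<open>The order of the factors is that of \<open>gcomm\<close>, so node values of words are
  commutators in this sense; \<open>derived_set\<close> is built from x y x^-1 y^-1 instead.\<close>

definition commutator :: "'a \<Rightarrow> 'a \<Rightarrow> 'a" where
  "commutator x y = inv x \<otimes> inv y \<otimes> x \<otimes> y"

definition conjugate :: "'a \<Rightarrow> 'a \<Rightarrow> 'a" where
  "conjugate g x = inv g \<otimes> x \<otimes> g"

lemma commutator_closed [simp]:
  "x \<in> carrier G \<Longrightarrow> y \<in> carrier G \<Longrightarrow> commutator x y \<in> carrier G"
  by (simp add: commutator_def)

lemma conjugate_closed [simp]:
  "g \<in> carrier G \<Longrightarrow> x \<in> carrier G \<Longrightarrow> conjugate g x \<in> carrier G"
  by (simp add: conjugate_def)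

lemma conjugate_one [simp]: "g \<in> carrier G \<Longrightarrow> conjugate g \<one> = \<one>"
  by (simp add: conjugate_def)

lemma conjugate_mult:
  assumes "g \<in> carrier G" "x \<in> carrier G" "y \<in> carrier G"
  shows "conjugate g (x \<otimes> y) = conjugate g x \<otimes> conjugate g y"
  using assms by (simp add: conjugate_def m_assoc)

lemma conjugate_commutator:
  assumes "g \<in> carrier G" "x \<in> carrier G" "y \<in> carrier G"
  shows "conjugate g (commutator x y) = commutator (conjugate g x) (conjugate g y)"
  using assms by (simp add: conjugate_def commutator_def m_assoc inv_mult_group)

lemma conjugate_eq_mult_commutator:
  assumes "g \<in> carrier G" "x \<in> carrier G"
  shows "conjugate g x = x \<otimes> commutator x g"
  using assms by (simp add: conjugate_def commutator_def m_assoc)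

lemma commutator_eq_inv_mult_conjugate:
  assumes "g \<in> carrier G" "x \<in> carrier G"
  shows "commutator x g = inv x \<otimes> conjugate g x"
  using assms by (simp add: conjugate_def commutator_def m_assoc)

lemma commutator_mult_left:
  assumes "x \<in> carrier G" "x' \<in> carrier G" "y \<in> carrier G"
  shows "commutator (x \<otimes> x') y = conjugate x' (commutator x y) \<otimes> commutator x' y"
  using assms by (simp add: conjugate_def commutator_def m_assoc inv_mult_group)

lemma commutator_mult_right:
  assumes "x \<in> carrier G" "y \<in> carrier G" "y' \<in> carrier G"
  shows "commutator x (y \<otimes> y') = commutator x y' \<otimes> conjugate y' (commutator x y)"
  using assms by (simp add: conjugate_def commutator_def m_assoc inv_mult_group)

lemma inv_commutator:
  assumes "x \<in> carrier G" "y \<in> carrier G"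
  shows "inv (commutator x y) = commutator y x"
  using assms by (simp add: commutator_def m_assoc inv_mult_group)

text \<open>Since inverting swaps the entries of a commutator, this form is chosen to keep the
  entries in their original normal sets. It makes \<open>commutator_set S T\<close> closed under
  inverses even for different \<open>S\<close> and \<open>T\<close>.\<close>

lemma commutator_inv_conjugate:
  assumes "x \<in> carrier G" "y \<in> carrier G"
  shows "commutator (inv x) (conjugate x y) = inv (commutator x y)"
  using assms by (simp add: commutator_def conjugate_def m_assoc inv_mult_group)

lemma commutator_one [simp]:
  "x \<in> carrier G \<Longrightarrow> commutator \<one> x = \<one>" "x \<in> carrier G \<Longrightarrow> commutator x \<one> = \<one>"
  by (simp_all add: commutator_def)

lemma normal_conjugate_closed:
  assumes "N \<lhd> G" "x \<in> N" "g \<in> carrier G"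
  shows "conjugate g x \<in> N"
  using normal.inv_op_closed1[OF assms(1,3,2)] by (simp add: conjugate_def)

lemma normal_commutator_closed:
  assumes "N \<lhd> G" "x \<in> N" "g \<in> carrier G"
  shows "commutator x g \<in> N" "commutator g x \<in> N"
proof -
  interpret N: normal N G by fact
  show "commutator x g \<in> N"
    using assms normal_conjugate_closed[OF assms]
    by (simp add: commutator_eq_inv_mult_conjugate N.mem_carrier)
  then have "inv (commutator x g) \<in> N"
    by simp
  then show "commutator g x \<in> N"
    using assms by (simp add: inv_commutator N.mem_carrier)
qed

section \<open>Products of a fixed number of factors\<close>

definition list_product :: "'a list \<Rightarrow> 'a" where
  "list_product xs = foldr (\<otimes>) xs \<one>"

lemma list_product_simps [simp]:
  "list_product [] = \<one>" "list_product (x # xs) = x \<otimes> list_product xs"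
  by (simp_all add: list_product_def)

lemma list_product_closed [simp]: "set xs \<subseteq> carrier G \<Longrightarrow> list_product xs \<in> carrier G"
  by (induction xs) auto

lemma list_product_append:
  "set xs \<subseteq> carrier G \<Longrightarrow> set ys \<subseteq> carrier G \<Longrightarrow>
    list_product (xs @ ys) = list_product xs \<otimes> list_product ys"
  by (induction xs) (auto simp: m_assoc)

text \<open>Exactly \<open>n\<close> factors are required, which makes lengths additive. If
  \<open>\<one>\<close> lies in \<open>S\<close>, shorter products can be padded, and the sets
  increase with \<open>n\<close>.\<close>

definition products :: "'a set \<Rightarrow> nat \<Rightarrow> 'a set" where
  "products S n = {list_product xs | xs. set xs \<subseteq> S \<and> length xs = n}"

lemma productsE:
  assumes "a \<in> products S n"
  obtains xs where "set xs \<subseteq> S" "length xs = n" "a = list_product xs"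
  using assms by (auto simp: products_def)

lemma productsI: "set xs \<subseteq> S \<Longrightarrow> list_product xs \<in> products S (length xs)"
  by (auto simp: products_def)

lemma products_0 [simp]: "products S 0 = {\<one>}"
  by (auto simp: products_def)

lemma products_Suc: "products S (Suc n) = {x \<otimes> y | x y. x \<in> S \<and> y \<in> products S n}"
proof (intro equalityI subsetI)
  fix a assume "a \<in> products S (Suc n)"
  then obtain xs where "set xs \<subseteq> S" "length xs = Suc n" "a = list_product xs"
    by (rule productsE)
  then show "a \<in> {x \<otimes> y | x y. x \<in> S \<and> y \<in> products S n}"
    by (cases xs) (auto simp: products_def)
next
  fix a assume "a \<in> {x \<otimes> y | x y. x \<in> S \<and> y \<in> products S n}"
  then obtain x xs where "x \<in> S" "set xs \<subseteq> S" "length xs = n" "a = x \<otimes> list_product xs"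
    by (auto elim: productsE)
  then show "a \<in> products S (Suc n)"
    using productsI[of "x # xs" S] by simp
qed

lemma finite_products: "finite S \<Longrightarrow> finite (products S n)"
  by (induction n) (simp_all add: products_Suc finite_image_set2)

lemma products_subset: "S \<subseteq> carrier G \<Longrightarrow> products S n \<subseteq> carrier G"
  by (auto simp: products_def)

lemma products_1: "S \<subseteq> carrier G \<Longrightarrow> products S 1 = S"
  by (force simp: products_Suc)

lemma products_mult:
  assumes "S \<subseteq> carrier G" "a \<in> products S m" "b \<in> products S n"
  shows "a \<otimes> b \<in> products S (m + n)"
proof -
  obtain xs ys where "set xs \<subseteq> S" "length xs = m" "a = list_product xs"
    "set ys \<subseteq> S" "length ys = n" "b = list_product ys"
    using assms(2,3) by (auto elim!: productsE)
  then show ?thesis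
    using productsI[of "xs @ ys" S] assms(1) by (auto simp: list_product_append)
qed

lemma products_mono:
  assumes "S \<subseteq> carrier G" "\<one> \<in> S" "m \<le> n"
  shows "products S m \<subseteq> products S n"
proof (rule lift_Suc_mono_le[OF _ \<open>m \<le> n\<close>])
  fix k
  show "products S k \<subseteq> products S (Suc k)"
  proof
    fix a assume a: "a \<in> products S k"
    then have "\<one> \<otimes> a = a"
      using subsetD[OF products_subset[OF assms(1)]] by simp
    with a assms(2) show "a \<in> products S (Suc k)"
      unfolding products_Suc by (metis (mono_tags, lifting) mem_Collect_eq)
  qed
qed

text \<open>These properties hold for the values of an outer commutator word on normal subgroups,
  although the values need not form a subgroup. Closure under inverses makes products of elements of
  \<open>S\<close> exhaust the generated subgroup; closure under conjugation lets factors be moved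
  past each other without changing their number.\<close>

definition symmetric_normal_set :: "'a set \<Rightarrow> bool" where
  "symmetric_normal_set S \<longleftrightarrow> S \<subseteq> carrier G \<and> \<one> \<in> S \<and> (\<forall>x\<in>S. inv x \<in> S) \<and>
    (\<forall>x\<in>S. \<forall>g\<in>carrier G. conjugate g x \<in> S)"

lemma symmetric_normal_setD:
  assumes "symmetric_normal_set S"
  shows "S \<subseteq> carrier G" "\<one> \<in> S" "x \<in> S \<Longrightarrow> x \<in> carrier G" "x \<in> S \<Longrightarrow> inv x \<in> S"
    "x \<in> S \<Longrightarrow> g \<in> carrier G \<Longrightarrow> conjugate g x \<in> S"
  using assms by (auto simp: symmetric_normal_set_def)

lemma normal_imp_symmetric_normal_set:
  assumes "N \<lhd> G"
  shows "symmetric_normal_set N"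
proof -
  interpret N: normal N G by fact
  show ?thesis
    using normal_conjugate_closed[OF assms] by (simp add: symmetric_normal_set_def N.subset)
qed

lemma products_conjugate:
  assumes S: "symmetric_normal_set S" and g: "g \<in> carrier G" and "a \<in> products S n"
  shows "conjugate g a \<in> products S n"
  using assms(3)
proof (induction n arbitrary: a)
  case 0
  then show ?case using g by simp
next
  case (Suc n)
  then obtain x y where a: "a = x \<otimes> y" "x \<in> S" "y \<in> products S n"
    by (auto simp: products_Suc)
  then have "conjugate g a = conjugate g x \<otimes> conjugate g y"
    using g symmetric_normal_setD(3)[OF S] products_subset[OF symmetric_normal_setD(1)[OF S]]
    by (auto intro: conjugate_mult)
  with a Suc.IH[of y] symmetric_normal_setD(5)[OF S _ g] show ?case
    by (auto simp: products_Suc)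
qed

lemma products_inv:
  assumes S: "symmetric_normal_set S" and "a \<in> products S n"
  shows "inv a \<in> products S n"
  using assms(2)
proof (induction n arbitrary: a)
  case 0
  then show ?case by simp
next
  case (Suc n)
  then obtain x y where a: "a = x \<otimes> y" "x \<in> S" "y \<in> products S n"
    by (auto simp: products_Suc)
  moreover have "x \<in> carrier G" "y \<in> carrier G"
    using a symmetric_normal_setD(1)[OF S] products_subset[of S n] by auto
  ultimately have "inv a = inv y \<otimes> inv x"
    by (simp add: inv_mult_group)
  also have "\<dots> \<in> products S (n + 1)"
    using a Suc.IH[of y] symmetric_normal_setD[OF S]
    by (intro products_mult) (auto simp: products_1[simplified])
  finally show ?case by simp
qed

lemma generate_eq_Union_products:
  assumes S: "symmetric_normal_set S"
  shows "generate G S = (\<Union>n. products S n)"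
proof (intro equalityI subsetI)
  note SG = symmetric_normal_setD(1)[OF S]
  fix a assume "a \<in> generate G S"
  then show "a \<in> (\<Union>n. products S n)"
  proof induction
    case one
    then show ?case using products_0 by blast
  next
    case (incl h)
    then show ?case using products_1[OF SG] by blast
  next
    case (inv h)
    then show ?case using products_1[OF SG] symmetric_normal_setD(4)[OF S] by blast
  next
    case (eng h1 h2)
    then show ?case using products_mult[OF SG] by blast
  qed
next
  fix a assume "a \<in> (\<Union>n. products S n)"
  then obtain n where "a \<in> products S n" by blast
  then show "a \<in> generate G S"
    by (induction n arbitrary: a) (auto simp: products_Suc intro: generate.intros)
qed

lemma generate_normal:
  assumes S: "symmetric_normal_set S"
  shows "generate G S \<lhd> G"
proof (rule normal_generateI)
  show "S \<subseteq> carrier G" using symmetric_normal_setD(1)[OF S] .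
  fix h g assume "h \<in> S" "g \<in> carrier G"
  then show "g \<otimes> h \<otimes> inv g \<in> S"
    using symmetric_normal_setD(5)[OF S, of h "inv g"] by (simp add: conjugate_def)
qed

section \<open>Sets of commutators\<close>

definition commutator_set :: "'a set \<Rightarrow> 'a set \<Rightarrow> 'a set" where
  "commutator_set S T = {commutator x y | x y. x \<in> S \<and> y \<in> T}"

lemma symmetric_normal_commutator_set:
  assumes S: "symmetric_normal_set S" and T: "symmetric_normal_set T"
  shows "symmetric_normal_set (commutator_set S T)"
proof -
  note SD = symmetric_normal_setD[OF S] and TD = symmetric_normal_setD[OF T]
  have "commutator_set S T \<subseteq> carrier G"
    using SD(3) TD(3) by (auto simp: commutator_set_def)
  moreover have "\<one> \<in> commutator_set S T"
    using SD(2) TD(2) commutator_one(1)[of \<one>] unfolding commutator_set_def by force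
  moreover have "inv c \<in> commutator_set S T" if c: "c \<in> commutator_set S T" for c
  proof -
    obtain x y where "c = commutator x y" "x \<in> S" "y \<in> T"
      using c by (auto simp: commutator_set_def)
    then have "inv c = commutator (inv x) (conjugate x y)" "inv x \<in> S" "conjugate x y \<in> T"
      using SD(3,4) TD(3,5) by (auto simp: commutator_inv_conjugate)
    then show ?thesis by (auto simp: commutator_set_def)
  qed
  moreover have "conjugate g c \<in> commutator_set S T"
    if c: "c \<in> commutator_set S T" and g: "g \<in> carrier G" for c g
  proof -
    obtain x y where "c = commutator x y" "x \<in> S" "y \<in> T"
      using c by (auto simp: commutator_set_def)
    then have "conjugate g c = commutator (conjugate g x) (conjugate g y)"
      "conjugate g x \<in> S" "conjugate g y \<in> T"
      using SD(3,5) TD(3,5) g by (auto simp: conjugate_commutator)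
    then show ?thesis by (auto simp: commutator_set_def)
  qed
  ultimately show ?thesis by (simp add: symmetric_normal_set_def)
qed

text \<open>Expanding both entries by the product rules for commutators yields one conjugate of a
  commutator for each pair of factors. The explicit length \<open>m * n\<close> is what carries
  finiteness conditions from a node of a tree to its children.\<close>

lemma commutator_products:
  assumes S: "symmetric_normal_set S" and T: "symmetric_normal_set T"
    and "a \<in> products S m" and "b \<in> products T n"
  shows "commutator a b \<in> products (commutator_set S T) (m * n)"
proof -
  note SD = symmetric_normal_setD[OF S] and TD = symmetric_normal_setD[OF T]
  let ?C = "commutator_set S T"
  have C: "symmetric_normal_set ?C"
    using S T by (rule symmetric_normal_commutator_set)
  note CG = symmetric_normal_setD(1)[OF C]
  \<comment> \<open>First a single factor on the left, by induction on the right entry; the left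
    entry is then expanded in a second induction.\<close>
  have single: "commutator x b \<in> products ?C n" if "x \<in> S" "b \<in> products T n" for x b n
    using that
  proof (induction n arbitrary: b)
    case 0
    then show ?case using SD(3) by simp
  next
    case (Suc n)
    then obtain y z where b: "b = y \<otimes> z" "y \<in> T" "z \<in> products T n"
      by (auto simp: products_Suc)
    then have cl: "x \<in> carrier G" "y \<in> carrier G" "z \<in> carrier G"
      using SD(3) TD(3) products_subset[OF TD(1)] Suc.prems(1) by auto
    have "commutator x y \<in> ?C"
      using Suc.prems(1) b by (auto simp: commutator_set_def)
    then have "conjugate z (commutator x y) \<in> products ?C 1"
      unfolding products_1[OF CG] using symmetric_normal_setD(5)[OF C] cl by auto
    moreover have "commutator x z \<in> products ?C n"
      using Suc b by auto
    ultimately have "commutator x z \<otimes> conjugate z (commutator x y) \<in> products ?C (n + 1)"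
      by (intro products_mult[OF CG])
    then show ?case
      using cl b by (simp add: commutator_mult_right)
  qed
  show ?thesis
    using assms(3)
  proof (induction m arbitrary: a)
    case 0
    then show ?case using subsetD[OF products_subset[OF TD(1)] assms(4)] by simp
  next
    case (Suc m)
    then obtain x z where a: "a = x \<otimes> z" "x \<in> S" "z \<in> products S m"
      by (auto simp: products_Suc)
    have cl: "x \<in> carrier G" "z \<in> carrier G" "b \<in> carrier G"
      using a SD(3) subsetD[OF products_subset[OF SD(1)]] subsetD[OF products_subset[OF TD(1)] assms(4)]
      by auto
    have "commutator x b \<in> products ?C n"
      using single a(2) assms(4) .
    then have "conjugate z (commutator x b) \<in> products ?C n"
      using products_conjugate[OF C] cl by auto
    moreover have "commutator z b \<in> products ?C (m * n)"
      using Suc.IH a by auto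
    ultimately have "conjugate z (commutator x b) \<otimes> commutator z b \<in> products ?C (n + m * n)"
      by (intro products_mult[OF CG])
    then show ?case
      using cl a by (simp add: commutator_mult_left)
  qed
qed

section \<open>Finiteness of subgroups generated by finite normal sets\<close>

text \<open>By a x^k = x^k (x^-k a x^k), a power of \<open>x\<close> passes to the left of a factor
  at the cost of conjugating that factor, which stays in \<open>S\<close>.\<close>

lemma pull_power_to_front:
  assumes S: "symmetric_normal_set S" and x: "x \<in> S"
    and "set xs \<subseteq> S" and "k \<le> count_list xs x"
  shows "list_product xs \<in> (\<lambda>b. x [^] k \<otimes> b) ` products S (length xs - k)"
  using assms(3,4)
proof (induction xs arbitrary: k)
  case Nil
  then show ?case by simp
next
  case (Cons a xs)
  note SD = symmetric_normal_setD[OF S]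
  have cl: "x \<in> carrier G" "a \<in> carrier G" "list_product xs \<in> carrier G"
    using Cons.prems SD(1) x by auto
  show ?case
  \<comment> \<open>For \<open>k = 0\<close> all required copies have been collected, so a further
    occurrence of \<open>x\<close> is treated like any other factor.\<close>
  proof (cases "a = x \<and> k > 0")
    case True
    then obtain j where j: "k = Suc j" using gr0_conv_Suc by auto
    obtain b where b: "b \<in> products S (length xs - j)" "list_product xs = x [^] j \<otimes> b"
      using Cons.IH[of j] Cons.prems True j by auto
    moreover have "b \<in> carrier G" using b products_subset[OF SD(1)] by auto
    ultimately have "list_product (a # xs) = x [^] k \<otimes> b"
      using True j cl by (metis list_product_simps(2) m_assoc nat_pow_Suc2 nat_pow_closed)
    with b j show ?thesis by auto
  next
    case False
    then have k: "k \<le> count_list xs x" using Cons.prems by (auto split: if_splits)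
    obtain b where b: "b \<in> products S (length xs - k)" "list_product xs = x [^] k \<otimes> b"
      using Cons.IH[OF _ k] Cons.prems by auto
    have bcl: "b \<in> carrier G" using b products_subset[OF SD(1)] by auto
    have "list_product (a # xs) = x [^] k \<otimes> (conjugate (x [^] k) a \<otimes> b)"
      using b bcl cl by (simp add: conjugate_def m_assoc)
    moreover have "conjugate (x [^] k) a \<in> S"
      using SD(5) Cons.prems cl by auto
    then have "conjugate (x [^] k) a \<otimes> b \<in> products S (Suc (length xs - k))"
      using b by (auto simp: products_Suc)
    moreover have "Suc (length xs - k) = length (a # xs) - k"
      using k count_le_length[of xs x] by simp
    ultimately show ?thesis by auto
  qed
qed

text \<open>A long product contains some \<open>x\<close> many times; collecting these occurrences in front
  produces a power that can be replaced by a shorter product.\<close>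

lemma finite_generate_of_short_powers:
  assumes S: "symmetric_normal_set S" and "finite S"
    and short: "\<And>x. x \<in> S \<Longrightarrow> \<exists>p. x [^] Suc p \<in> products S p"
  shows "finite (generate G S)"
proof -
  note SD = symmetric_normal_setD[OF S]
  obtain p where p: "\<And>x. x \<in> S \<Longrightarrow> x [^] Suc (p x) \<in> products S (p x)"
    using short by metis
  \<comment> \<open>Pigeonhole bound: if no \<open>x\<close> in \<open>S\<close> occurs more than
    \<open>p x\<close> times in a list, the list has length at most \<open>P\<close>.\<close>
  define P where "P = sum p S"
  have shorten: "products S (Suc n) \<subseteq> products S n" if n: "n \<ge> P" for n
  proof
    fix a assume "a \<in> products S (Suc n)"
    then obtain xs where xs: "set xs \<subseteq> S" "length xs = Suc n" "a = list_product xs"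
      by (rule productsE)
    have "\<exists>x\<in>S. Suc (p x) \<le> count_list xs x"
    proof (rule ccontr)
      assume "\<not> ?thesis"
      then have "sum (count_list xs) S \<le> P"
        unfolding P_def by (intro sum_mono) (auto simp: not_less_eq_eq)
      moreover have "sum (count_list xs) S = length xs"
        using xs(1) \<open>finite S\<close> by (rule sum_count_set)
      ultimately show False using xs(2) n by simp
    qed
    then obtain x where x: "x \<in> S" "Suc (p x) \<le> count_list xs x" by blast
    then obtain b where b: "b \<in> products S (length xs - Suc (p x))" "a = x [^] Suc (p x) \<otimes> b"
      using pull_power_to_front[OF S x(1) xs(1) x(2)] xs(3) by auto
    then have "a \<in> products S (p x + (length xs - Suc (p x)))"
      using products_mult[OF SD(1) p[OF x(1)]] by blast
    moreover have "p x + (length xs - Suc (p x)) = n"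
      using x(2) count_le_length[of xs x] xs(2) by simp
    ultimately show "a \<in> products S n" by simp
  qed
  have "products S n \<subseteq> products S P" for n
  proof (cases "n \<le> P")
    case True
    then show ?thesis by (rule products_mono[OF SD(1,2)])
  next
    case False
    then have "P \<le> n" by simp
    then show ?thesis
      by (induction n rule: dec_induct) (use shorten in blast)+
  qed
  then have "generate G S \<subseteq> products S P"
    unfolding generate_eq_Union_products[OF S] by blast
  then show ?thesis
    using finite_products[OF \<open>finite S\<close>] finite_subset by blast
qed

lemma finite_powers_imp_torsion:
  assumes "x \<in> carrier G" and "finite (range (\<lambda>k::nat. x [^] k))"
  obtains n :: nat where "n > 0" "x [^] n = \<one>"
proof -
  have "\<not> inj (\<lambda>k::nat. x [^] k)"
    using assms(2) finite_imageD infinite_UNIV_nat by blast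
  then obtain i j :: nat where "i < j" "x [^] j = x [^] i"
    unfolding inj_def by (metis nat_neq_iff)
  then show ?thesis
    using that[of "j - i"] pow_eq_div2[OF assms(1)] by simp
qed

end

section \<open>Outer commutator words with normal subgroups as entries\<close>

text \<open>Leaves carry the subgroups instead of variables: as the variables of the word are
  distinct, each leaf ranges over its subgroup independently.\<close>

datatype 'a commutator_tree = Leaf "'a set" | Node "'a commutator_tree" "'a commutator_tree"

text \<open>Along the leftmost path the word has the shape [x, c_1, ..., c_d], with x from
  \<open>leftmost\<close>, one entry c_i for each sibling on the path, and d given by
  \<open>left_depth\<close>.\<close>

primrec leftmost :: "'a commutator_tree \<Rightarrow> 'a set" where
  "leftmost (Leaf N) = N"
| "leftmost (Node l r) = leftmost l"

primrec left_depth :: "'a commutator_tree \<Rightarrow> nat" where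
  "left_depth (Leaf N) = 0"
| "left_depth (Node l r) = Suc (left_depth l)"

primrec normal_leaves :: "('a, 'b) monoid_scheme \<Rightarrow> 'a commutator_tree \<Rightarrow> bool" where
  "normal_leaves G (Leaf N) \<longleftrightarrow> N \<lhd> G"
| "normal_leaves G (Node l r) \<longleftrightarrow> normal_leaves G l \<and> normal_leaves G r"

context group
begin

primrec tree_values :: "'a commutator_tree \<Rightarrow> 'a set" where
  "tree_values (Leaf N) = N"
| "tree_values (Node l r) = commutator_set (tree_values l) (tree_values r)"

definition tree_subgroup :: "'a commutator_tree \<Rightarrow> 'a set" where
  "tree_subgroup t = generate G (tree_values t)"

lemma symmetric_normal_tree_values:
  "normal_leaves G t \<Longrightarrow> symmetric_normal_set (tree_values t)"
  by (induction t) (simp_all add: normal_imp_symmetric_normal_set symmetric_normal_commutator_set)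

lemma tree_subgroup_normal: "normal_leaves G t \<Longrightarrow> tree_subgroup t \<lhd> G"
  by (simp add: tree_subgroup_def generate_normal symmetric_normal_tree_values)

lemma tree_subgroup_eq_products:
  "normal_leaves G t \<Longrightarrow> tree_subgroup t = (\<Union>n. products (tree_values t) n)"
  by (simp add: tree_subgroup_def generate_eq_Union_products symmetric_normal_tree_values)

lemma tree_subgroupE:
  assumes "normal_leaves G t" "a \<in> tree_subgroup t"
  obtains n where "a \<in> products (tree_values t) n"
  using assms by (auto simp: tree_subgroup_eq_products)

lemma tree_subgroup_closed: "normal_leaves G t \<Longrightarrow> a \<in> tree_subgroup t \<Longrightarrow> a \<in> carrier G"
  using subgroup.subset[OF normal_imp_subgroup[OF tree_subgroup_normal]] by blast

lemma tree_values_subset: "tree_values t \<subseteq> tree_subgroup t"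
  by (auto simp: tree_subgroup_def intro: generate.incl)

lemma tree_subgroup_Leaf:
  assumes "N \<lhd> G"
  shows "tree_subgroup (Leaf N) = N"
  using generate_subgroup_incl[OF subset_refl normal_imp_subgroup[OF assms]]
    tree_values_subset[of "Leaf N"]
  by (simp add: tree_subgroup_def subset_antisym)

lemma commutator_in_tree_subgroup:
  assumes "normal_leaves G (Node l r)" "a \<in> tree_subgroup l" "b \<in> tree_subgroup r"
  shows "commutator a b \<in> tree_subgroup (Node l r)"
proof -
  obtain m n where "a \<in> products (tree_values l) m" "b \<in> products (tree_values r) n"
    using assms by (auto elim!: tree_subgroupE)
  then have "commutator a b \<in> products (tree_values (Node l r)) (m * n)"
    using assms(1) by (simp add: commutator_products symmetric_normal_tree_values)
  then show ?thesis
    using assms(1) by (auto simp only: tree_subgroup_eq_products)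
qed

lemma tree_subgroup_Node_subset:
  assumes "normal_leaves G (Node l r)"
  shows "tree_subgroup (Node l r) \<subseteq> tree_subgroup l"
    and "tree_subgroup (Node l r) \<subseteq> tree_subgroup r"
proof -
  have n: "normal_leaves G l" "normal_leaves G r" using assms by auto
  have "tree_values (Node l r) \<subseteq> tree_subgroup l \<inter> tree_subgroup r"
    using tree_values_subset[of l] tree_values_subset[of r]
      normal_commutator_closed[OF tree_subgroup_normal[OF n(1)]]
      normal_commutator_closed[OF tree_subgroup_normal[OF n(2)]]
      tree_subgroup_closed[OF n(1)] tree_subgroup_closed[OF n(2)]
    by (auto simp: commutator_set_def subset_iff)
  then show "tree_subgroup (Node l r) \<subseteq> tree_subgroup l"
    and "tree_subgroup (Node l r) \<subseteq> tree_subgroup r"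
    unfolding tree_subgroup_def[of "Node l r"]
    using generate_subgroup_incl[OF _ normal_imp_subgroup[OF tree_subgroup_normal]] n by auto
qed

lemma tree_subgroup_subset_leftmost:
  "normal_leaves G t \<Longrightarrow> tree_subgroup t \<subseteq> leftmost t"
proof (induction t)
  case (Leaf N)
  then show ?case by (simp add: tree_subgroup_Leaf)
next
  case (Node l r)
  then show ?case using tree_subgroup_Node_subset(1)[OF Node.prems] by auto
qed

text \<open>Every sibling of a node on the leftmost path contains \<open>tree_subgroup t\<close>, so its
  elements are admissible entries there; the bound \<open>n\<close> does not depend on \<open>x\<close>.\<close>

lemma iterated_commutator_in_products:
  assumes "normal_leaves G t" and "set ls \<subseteq> tree_subgroup t" and "length ls = left_depth t"
  shows "\<exists>n. \<forall>x\<in>leftmost t. foldl commutator x ls \<in> products (tree_values t) n"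
  using assms
proof (induction t arbitrary: ls)
  case (Leaf N)
  then have "products N 1 = N"
    by (intro products_1) (simp add: normal_imp_subgroup subgroup.subset)
  then show ?case using Leaf by auto
next
  case (Node l r)
  have n: "normal_leaves G l" "normal_leaves G r" using Node.prems by auto
  \<comment> \<open>The last entry belongs to the right child of the root; the earlier ones belong
    to the path inside the left child.\<close>
  obtain ks k where ls: "ls = ks @ [k]" "length ks = left_depth l"
    using Node.prems(3) by (cases ls rule: rev_cases) auto
  have "set ks \<subseteq> tree_subgroup l" "k \<in> tree_subgroup r"
    using tree_subgroup_Node_subset[OF Node.prems(1)] Node.prems(2) ls by auto
  then obtain m j where "\<forall>x\<in>leftmost l. foldl commutator x ks \<in> products (tree_values l) m"
    "k \<in> products (tree_values r) j"
    using Node.IH(1)[OF n(1) _ ls(2)] n by (auto elim!: tree_subgroupE)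
  then have "\<forall>x\<in>leftmost (Node l r). foldl commutator x ls \<in> products (tree_values (Node l r)) (m * j)"
    using n ls by (simp add: commutator_products symmetric_normal_tree_values)
  then show ?case by blast
qed

end

section \<open>Homomorphisms to torsion-free abelian groups\<close>

locale torsion_free_comm_group = comm_group +
  assumes torsion_free: "x \<in> carrier G \<Longrightarrow> n > 0 \<Longrightarrow> x [^] (n::nat) = \<one> \<Longrightarrow> x = \<one>"

context group
begin

text \<open>The second condition is what remains of the finiteness of the set of values
  on passing from a node to its children.\<close>

definition bounded_hom ::
  "('c, 'd) monoid_scheme \<Rightarrow> 'a commutator_tree \<Rightarrow> ('a \<Rightarrow> 'c) \<Rightarrow> bool" where
  "bounded_hom H t f \<longleftrightarrow> f \<in> hom (G\<lparr>carrier := tree_subgroup t\<rparr>) H \<and>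
    (\<forall>n. finite (f ` products (tree_values t) n))"

context
  fixes H :: "('c, 'd) monoid_scheme"
  assumes H: "torsion_free_comm_group H"
begin

interpretation H: torsion_free_comm_group H
  by (rule H)

lemma bounded_homD:
  assumes "bounded_hom H t f"
  shows "a \<in> tree_subgroup t \<Longrightarrow> f a \<in> carrier H"
    and "a \<in> tree_subgroup t \<Longrightarrow> b \<in> tree_subgroup t \<Longrightarrow> f (a \<otimes> b) = f a \<otimes>\<^bsub>H\<^esub> f b"
    and "finite (f ` products (tree_values t) n)"
  using assms by (auto simp: bounded_hom_def hom_def)

lemma bounded_homI:
  assumes "\<And>a. a \<in> tree_subgroup t \<Longrightarrow> f a \<in> carrier H"
    and "\<And>a b. a \<in> tree_subgroup t \<Longrightarrow> b \<in> tree_subgroup t \<Longrightarrow> f (a \<otimes> b) = f a \<otimes>\<^bsub>H\<^esub> f b"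
    and "\<And>n. finite (f ` products (tree_values t) n)"
  shows "bounded_hom H t f"
  using assms by (auto simp: bounded_hom_def hom_def)

lemma bounded_hom_group_hom:
  assumes "normal_leaves G t" "bounded_hom H t f"
  shows "group_hom (G\<lparr>carrier := tree_subgroup t\<rparr>) H f"
proof -
  have "group (G\<lparr>carrier := tree_subgroup t\<rparr>)"
    using assms(1) normal_imp_subgroup subgroup_imp_group tree_subgroup_normal by blast
  then show ?thesis
    using assms(2) by (simp add: bounded_hom_def group_hom_def group_hom_axioms_def)
qed

lemma bounded_hom_commutator_eq_one:
  assumes "normal_leaves G t" "bounded_hom H t f" "a \<in> tree_subgroup t" "b \<in> tree_subgroup t"
  shows "f (commutator a b) = \<one>\<^bsub>H\<^esub>"
proof -
  interpret A: normal "tree_subgroup t" G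
    using assms(1) by (rule tree_subgroup_normal)
  interpret f: group_hom "G\<lparr>carrier := tree_subgroup t\<rparr>" H f
    using assms(1,2) by (rule bounded_hom_group_hom)
  have inv: "f (inv c) = inv\<^bsub>H\<^esub> f c" if "c \<in> tree_subgroup t" for c
    using f.hom_inv[of c] that m_inv_consistent[OF A.subgroup_axioms that] by simp
  note cl = bounded_homD(1)[OF assms(2)]
  show ?thesis
    using assms(3,4) cl[OF assms(3)] cl[OF assms(4)]
    by (simp add: commutator_def bounded_homD(2)[OF assms(2)] inv H.m_ac)
qed

text \<open>Follows from a^g = a [a, g]. It removes the conjugations in the product rules for
  commutators, turning them into additivity under \<open>f\<close>.\<close>

lemma bounded_hom_conjugate:
  assumes "normal_leaves G t" "bounded_hom H t f" "a \<in> tree_subgroup t" "g \<in> carrier G"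
    and "f (commutator a g) = \<one>\<^bsub>H\<^esub>"
  shows "f (conjugate g a) = f a"
proof -
  note N = tree_subgroup_normal[OF assms(1)]
  have "conjugate g a = a \<otimes> commutator a g"
    using assms tree_subgroup_closed by (intro conjugate_eq_mult_commutator) auto
  then show ?thesis
    using assms(3,4,5) normal_commutator_closed(1)[OF N assms(3,4)] bounded_homD[OF assms(2)]
    by simp
qed

text \<open>The powers of \<open>f a\<close> are the images of the powers of \<open>a\<close>, so
  they lie in a finite set; hence \<open>f a\<close> is torsion.\<close>

lemma finite_range_imp_trivial:
  assumes "normal_leaves G t" "bounded_hom H t f" "finite (f ` tree_subgroup t)"
    and "a \<in> tree_subgroup t"
  shows "f a = \<one>\<^bsub>H\<^esub>"
proof -
  interpret A: normal "tree_subgroup t" G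
    using assms(1) by (rule tree_subgroup_normal)
  have pow: "a [^] k \<in> tree_subgroup t \<and> f (a [^] k) = f a [^]\<^bsub>H\<^esub> k" for k :: nat
  proof (induction k)
    case 0
    interpret f: group_hom "G\<lparr>carrier := tree_subgroup t\<rparr>" H f
      using assms(1,2) by (rule bounded_hom_group_hom)
    show ?case using f.hom_one by simp
  next
    case (Suc k)
    then show ?case using assms(4) bounded_homD(2)[OF assms(2)] by simp
  qed
  have "range (\<lambda>k::nat. f a [^]\<^bsub>H\<^esub> k) \<subseteq> f ` tree_subgroup t"
    using pow by (metis image_eqI image_subsetI)
  then have "finite (range (\<lambda>k::nat. f a [^]\<^bsub>H\<^esub> k))"
    using assms(3) finite_subset by blast
  then show ?thesis
    using H.finite_powers_imp_torsion H.torsion_free bounded_homD(1)[OF assms(2,4)] by metis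
qed

text \<open>In [ab, g] = [a, g]^b [b, g] both [a, g] and b lie in the domain, so the conjugation by
  b is invisible in the abelian group \<open>H\<close>. For the finiteness clause, [a, g] = a^-1 a^g
  has twice as many factors as a.\<close>

lemma bounded_hom_commutator:
  assumes t: "normal_leaves G t" and f: "bounded_hom H t f" and g: "g \<in> carrier G"
  shows "bounded_hom H t (\<lambda>x. f (commutator x g))"
proof (rule bounded_homI)
  note N = tree_subgroup_normal[OF t]
  note cl = tree_subgroup_closed[OF t] and comm = normal_commutator_closed(1)[OF N _ g]
  fix a assume a: "a \<in> tree_subgroup t"
  then show "f (commutator a g) \<in> carrier H"
    using bounded_homD(1)[OF f] comm by blast
  fix b assume b: "b \<in> tree_subgroup t"
  have "f (commutator (a \<otimes> b) g) = f (conjugate b (commutator a g)) \<otimes>\<^bsub>H\<^esub> f (commutator b g)"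
    using a b g cl comm normal_conjugate_closed[OF N]
    by (simp add: commutator_mult_left bounded_homD(2)[OF f])
  also have "f (conjugate b (commutator a g)) = f (commutator a g)"
    using a b cl comm t f
    by (intro bounded_hom_conjugate[OF t f] bounded_hom_commutator_eq_one[OF t f]) auto
  finally show "f (commutator (a \<otimes> b) g) = f (commutator a g) \<otimes>\<^bsub>H\<^esub> f (commutator b g)" .
next
  fix n
  note V = symmetric_normal_tree_values[OF t]
  note VG = symmetric_normal_setD(1)[OF V]
  have "commutator a g \<in> products (tree_values t) (n + n)"
    if a: "a \<in> products (tree_values t) n" for a
    using products_mult[OF VG products_inv[OF V a] products_conjugate[OF V g a]]
      subsetD[OF products_subset[OF VG] a] g
    by (simp add: commutator_eq_inv_mult_conjugate)
  then have "(\<lambda>x. f (commutator x g)) ` products (tree_values t) n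
      \<subseteq> f ` products (tree_values t) (n + n)"
    by auto
  then show "finite ((\<lambda>x. f (commutator x g)) ` products (tree_values t) n)"
    using bounded_homD(3)[OF f] finite_subset by blast
qed

lemma bounded_hom_iterated_commutator:
  assumes "normal_leaves G t" "bounded_hom H t f" "set ls \<subseteq> carrier G"
  shows "bounded_hom H t (\<lambda>x. f (foldl commutator x ls))"
  using assms(3)
proof (induction ls)
  case Nil
  then show ?case using assms(2) by simp
next
  case (Cons l ls)
  then show ?case
    using bounded_hom_commutator[OF assms(1), of "\<lambda>x. f (foldl commutator x ls)" l] by simp
qed

text \<open>Here the conjugating element b in [ab, y] = [a, y]^b [b, y] lies only in the left child,
  so \<open>kill\<close> is what makes \<open>f\<close> ignore it. Since \<open>y\<close> is a
  product of some fixed number m of values, products of length n are sent into the image of products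
  of length n m.\<close>

lemma bounded_hom_left_child:
  assumes t: "normal_leaves G (Node l r)" and f: "bounded_hom H (Node l r) f"
    and kill: "\<And>x a. x \<in> tree_subgroup (Node l r) \<Longrightarrow> a \<in> tree_subgroup l \<Longrightarrow>
      f (commutator x a) = \<one>\<^bsub>H\<^esub>"
    and y: "y \<in> tree_subgroup r"
  shows "bounded_hom H l (\<lambda>a. f (commutator a y))"
proof (rule bounded_homI)
  have n: "normal_leaves G l" "normal_leaves G r" using t by auto
  note N = tree_subgroup_normal[OF t]
  note cl = tree_subgroup_closed[OF n(1)] and ycl = tree_subgroup_closed[OF n(2) y]
  note comm = commutator_in_tree_subgroup[OF t _ y]
  fix a assume a: "a \<in> tree_subgroup l"
  then show "f (commutator a y) \<in> carrier H"
    using bounded_homD(1)[OF f] comm by blast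
  fix b assume b: "b \<in> tree_subgroup l"
  have "f (commutator (a \<otimes> b) y) = f (conjugate b (commutator a y)) \<otimes>\<^bsub>H\<^esub> f (commutator b y)"
    using a b cl ycl comm normal_conjugate_closed[OF N]
    by (simp add: commutator_mult_left bounded_homD(2)[OF f])
  also have "f (conjugate b (commutator a y)) = f (commutator a y)"
    using a b cl comm by (intro bounded_hom_conjugate[OF t f] kill) auto
  finally show "f (commutator (a \<otimes> b) y) = f (commutator a y) \<otimes>\<^bsub>H\<^esub> f (commutator b y)" .
next
  fix n
  obtain m where "y \<in> products (tree_values r) m"
    using t y by (auto elim: tree_subgroupE)
  then have "(\<lambda>a. f (commutator a y)) ` products (tree_values l) n
      \<subseteq> f ` products (tree_values (Node l r)) (n * m)"
    using t by (auto intro!: imageI commutator_products symmetric_normal_tree_values)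
  then show "finite ((\<lambda>a. f (commutator a y)) ` products (tree_values l) n)"
    using bounded_homD(3)[OF f] finite_subset by blast
qed

text \<open>The mirror image of the left case, except that expanding the second entry reverses the
  order of the factors; commutativity of \<open>H\<close> restores it.\<close>

lemma bounded_hom_right_child:
  assumes t: "normal_leaves G (Node l r)" and f: "bounded_hom H (Node l r) f"
    and kill: "\<And>x b. x \<in> tree_subgroup (Node l r) \<Longrightarrow> b \<in> tree_subgroup r \<Longrightarrow>
      f (commutator x b) = \<one>\<^bsub>H\<^esub>"
    and x: "x \<in> tree_subgroup l"
  shows "bounded_hom H r (\<lambda>b. f (commutator x b))"
proof (rule bounded_homI)
  have n: "normal_leaves G l" "normal_leaves G r" using t by auto
  note N = tree_subgroup_normal[OF t]
  note cl = tree_subgroup_closed[OF n(2)] and xcl = tree_subgroup_closed[OF n(1) x]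
  note comm = commutator_in_tree_subgroup[OF t x]
  fix a assume a: "a \<in> tree_subgroup r"
  then show c: "f (commutator x a) \<in> carrier H"
    using bounded_homD(1)[OF f] comm by blast
  fix b assume b: "b \<in> tree_subgroup r"
  have "f (commutator x (a \<otimes> b)) = f (commutator x b) \<otimes>\<^bsub>H\<^esub> f (conjugate b (commutator x a))"
    using a b cl xcl comm normal_conjugate_closed[OF N]
    by (simp add: commutator_mult_right bounded_homD(2)[OF f])
  also have "f (conjugate b (commutator x a)) = f (commutator x a)"
    using a b cl comm by (intro bounded_hom_conjugate[OF t f] kill) auto
  also have "f (commutator x b) \<otimes>\<^bsub>H\<^esub> f (commutator x a) = f (commutator x a) \<otimes>\<^bsub>H\<^esub> f (commutator x b)"
    using c bounded_homD(1)[OF f comm[OF b]] by (rule H.m_comm[rotated])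
  finally show "f (commutator x (a \<otimes> b)) = f (commutator x a) \<otimes>\<^bsub>H\<^esub> f (commutator x b)" .
next
  fix n
  obtain m where "x \<in> products (tree_values l) m"
    using t x by (auto elim: tree_subgroupE)
  then have "(\<lambda>b. f (commutator x b)) ` products (tree_values r) n
      \<subseteq> f ` products (tree_values (Node l r)) (m * n)"
    using t by (auto intro!: imageI commutator_products symmetric_normal_tree_values)
  then show "finite ((\<lambda>b. f (commutator x b)) ` products (tree_values r) n)"
    using bounded_homD(3)[OF f] finite_subset by blast
qed

lemma bounded_hom_trivial_on_values:
  assumes t: "normal_leaves G t" and f: "bounded_hom H t f"
    and triv: "\<And>v. v \<in> tree_values t \<Longrightarrow> f v = \<one>\<^bsub>H\<^esub>" and a: "a \<in> tree_subgroup t"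
  shows "f a = \<one>\<^bsub>H\<^esub>"
proof -
  interpret f: group_hom "G\<lparr>carrier := tree_subgroup t\<rparr>" H f
    using t f by (rule bounded_hom_group_hom)
  have "f b = \<one>\<^bsub>H\<^esub>" if "b \<in> products (tree_values t) n" for b n
    using that
  proof (induction n arbitrary: b)
    case 0
    then show ?case using f.hom_one by simp
  next
    case (Suc n)
    then obtain x y where "b = x \<otimes> y" "x \<in> tree_values t" "y \<in> products (tree_values t) n"
      by (auto simp: products_Suc)
    moreover from this have "x \<in> tree_subgroup t" "y \<in> tree_subgroup t"
      using tree_values_subset[of t] tree_subgroup_eq_products[OF t] by auto
    ultimately show ?case
      using bounded_homD(2)[OF f] triv Suc.IH by simp
  qed
  with a t show ?thesis by (auto elim: tree_subgroupE)
qed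

text \<open>If no child acts trivially on the domain modulo the kernel, one passes to
  \<open>\<lambda>x. f (commutator x c)\<close> with \<open>c\<close> from the left child. Substituting the whole
  subgroup for the leftmost leaf of the right child shows that this map kills sufficiently
  long commutators with entries from the right child.\<close>

theorem bounded_hom_trivial:
  assumes "normal_leaves G t" and "bounded_hom H t f" and "a \<in> tree_subgroup t"
  shows "f a = \<one>\<^bsub>H\<^esub>"
  using assms
proof (induction t arbitrary: f a)
  case (Leaf N)
  then have "products N 1 = N"
    by (intro products_1) (simp add: normal_imp_subgroup subgroup.subset)
  then have "finite (f ` tree_subgroup (Leaf N))"
    using bounded_homD(3)[OF Leaf.prems(2), of 1] Leaf.prems(1) by (simp add: tree_subgroup_Leaf)
  then show ?case
    using Leaf.prems finite_range_imp_trivial by blast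
next
  case (Node l r)
  let ?t = "Node l r"
  note t = Node.prems(1)
  have n: "normal_leaves G l" "normal_leaves G r" using t by auto
  note lcl = tree_subgroup_closed[OF n(1)] and rcl = tree_subgroup_closed[OF n(2)]
  have left: "h b = \<one>\<^bsub>H\<^esub>"
    if h: "bounded_hom H ?t h" and b: "b \<in> tree_subgroup ?t"
      and kill: "\<And>x c. x \<in> tree_subgroup ?t \<Longrightarrow> c \<in> tree_subgroup l \<Longrightarrow>
        h (commutator x c) = \<one>\<^bsub>H\<^esub>"
    for h b
  proof (rule bounded_hom_trivial_on_values[OF t h _ b])
    fix v assume "v \<in> tree_values ?t"
    then obtain x y where v: "v = commutator x y" "x \<in> tree_values l" "y \<in> tree_values r"
      by (auto simp: commutator_set_def)
    then have "x \<in> tree_subgroup l" "y \<in> tree_subgroup r"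
      using tree_values_subset by auto
    then show "h v = \<one>\<^bsub>H\<^esub>"
      using Node.IH(1)[OF n(1) bounded_hom_left_child[OF t h kill]] v(1) by blast
  qed
  have right: "h b = \<one>\<^bsub>H\<^esub>"
    if h: "bounded_hom H ?t h" and b: "b \<in> tree_subgroup ?t"
      and kill: "\<And>x c. x \<in> tree_subgroup ?t \<Longrightarrow> c \<in> tree_subgroup r \<Longrightarrow>
        h (commutator x c) = \<one>\<^bsub>H\<^esub>"
    for h b
  proof (rule bounded_hom_trivial_on_values[OF t h _ b])
    fix v assume "v \<in> tree_values ?t"
    then obtain x y where v: "v = commutator x y" "x \<in> tree_values l" "y \<in> tree_values r"
      by (auto simp: commutator_set_def)
    then have "x \<in> tree_subgroup l" "y \<in> tree_subgroup r"
      using tree_values_subset by auto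
    then show "h v = \<one>\<^bsub>H\<^esub>"
      using Node.IH(2)[OF n(2) bounded_hom_right_child[OF t h kill]] v(1) by blast
  qed
  \<comment> \<open>Induction on the length of the commutators killed: z -> h [z, c] kills those of
    length \<open>d\<close> because appending \<open>c\<close> gives one of length
    \<open>Suc d\<close>. Thus \<open>h\<close> kills every [x, c] with c from the right child, and
    \<open>right\<close> applies.\<close>
  have nilpotent: "h b = \<one>\<^bsub>H\<^esub>"
    if "bounded_hom H ?t h" "b \<in> tree_subgroup ?t"
      "\<And>x ls. x \<in> tree_subgroup ?t \<Longrightarrow> set ls \<subseteq> tree_subgroup r \<Longrightarrow> length ls = d \<Longrightarrow>
        h (foldl commutator x ls) = \<one>\<^bsub>H\<^esub>"
    for d h b
    using that
  proof (induction d arbitrary: h b)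
    case 0
    then show ?case using "0.prems"(3)[of b "[]"] by simp
  next
    case (Suc d)
    show ?case
    proof (rule right[OF Suc.prems(1,2)])
      fix x c assume x: "x \<in> tree_subgroup ?t" and c: "c \<in> tree_subgroup r"
      show "h (commutator x c) = \<one>\<^bsub>H\<^esub>"
      proof (rule Suc.IH[OF bounded_hom_commutator[OF t Suc.prems(1) rcl[OF c]] x])
        fix z ls
        assume "z \<in> tree_subgroup ?t" "set ls \<subseteq> tree_subgroup r" "length ls = d"
        then show "h (commutator (foldl commutator z ls) c) = \<one>\<^bsub>H\<^esub>"
          using Suc.prems(3)[of z "ls @ [c]"] c by simp
      qed
    qed
  qed
  have "f (commutator x c) = \<one>\<^bsub>H\<^esub>" if x: "x \<in> tree_subgroup ?t" and c: "c \<in> tree_subgroup l"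
    for x c
  proof (rule nilpotent[of _ _ "left_depth r",
        OF bounded_hom_commutator[OF t Node.prems(2) lcl[OF c]] x])
    fix z ls
    assume z: "z \<in> tree_subgroup ?t" and ls: "set ls \<subseteq> tree_subgroup r" "length ls = left_depth r"
    let ?h = "\<lambda>z. f (commutator (foldl commutator z ls) c)"
    \<comment> \<open>The outer commutator with \<open>c\<close> is absorbed by appending
      \<open>c\<close> to the list of entries.\<close>
    have h: "bounded_hom H ?t ?h"
      using bounded_hom_iterated_commutator[OF t Node.prems(2), of "ls @ [c]"] ls(1) rcl lcl[OF c]
      by auto
    obtain k where k: "\<And>z. z \<in> leftmost r \<Longrightarrow> foldl commutator z ls \<in> products (tree_values r) k"
      using iterated_commutator_in_products[OF n(2) ls] by blast
    obtain m where m: "c \<in> products (tree_values l) m"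
      using n(1) c by (rule tree_subgroupE)
    note V = symmetric_normal_tree_values[OF t]
    have "commutator (foldl commutator z ls) c \<in> products (tree_values ?t) (m * k)"
      if z: "z \<in> tree_subgroup ?t" for z
    proof -
      have "z \<in> leftmost r"
        using z tree_subgroup_Node_subset(2)[OF t] tree_subgroup_subset_leftmost[OF n(2)] by blast
      note zk = k[OF this]
      \<comment> \<open>The entry from the left child must come first to obtain a product of values;
        the commutator wanted is the inverse of this one.\<close>
      have "commutator c (foldl commutator z ls) \<in> products (tree_values ?t) (m * k)"
        using commutator_products[OF _ _ m zk] n symmetric_normal_tree_values by simp
      then have "inv (commutator c (foldl commutator z ls)) \<in> products (tree_values ?t) (m * k)"
        by (rule products_inv[OF V])
      moreover have "foldl commutator z ls \<in> carrier G"
        using zk products_subset[OF symmetric_normal_setD(1)[OF symmetric_normal_tree_values[OF n(2)]]]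
        by blast
      ultimately show ?thesis
        using lcl[OF c] by (simp add: inv_commutator)
    qed
    \<comment> \<open>The length \<open>m * k\<close> is the same for all \<open>z\<close>, so the
      finiteness clause for one length bounds the whole image.\<close>
    then have "?h ` tree_subgroup ?t \<subseteq> f ` products (tree_values ?t) (m * k)"
      by blast
    then have "finite (?h ` tree_subgroup ?t)"
      using bounded_homD(3)[OF Node.prems(2)] finite_subset by blast
    then show "?h z = \<one>\<^bsub>H\<^esub>"
      using finite_range_imp_trivial[OF t h _ z] by blast
  qed
  then show ?case
    using left[OF Node.prems(2,3)] by blast
qed

end

end

section \<open>Torsion of the values\<close>

context comm_group
begin

lemma torsion_subgroup: "subgroup {x \<in> carrier G. \<exists>n::nat. n > 0 \<and> x [^] n = \<one>} G"
proof (rule subgroupI)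
  show "{x \<in> carrier G. \<exists>n::nat. n > 0 \<and> x [^] n = \<one>} \<noteq> {}"
    using nat_pow_one[of 1] one_closed by blast
next
  fix x assume "x \<in> {x \<in> carrier G. \<exists>n::nat. n > 0 \<and> x [^] n = \<one>}"
  then show "inv x \<in> {x \<in> carrier G. \<exists>n::nat. n > 0 \<and> x [^] n = \<one>}"
    using nat_pow_inv by fastforce
next
  fix x y
  assume "x \<in> {x \<in> carrier G. \<exists>n::nat. n > 0 \<and> x [^] n = \<one>}"
    and "y \<in> {x \<in> carrier G. \<exists>n::nat. n > 0 \<and> x [^] n = \<one>}"
  then obtain m n :: nat where mn: "x \<in> carrier G" "y \<in> carrier G" "m > 0" "n > 0"
    "x [^] m = \<one>" "y [^] n = \<one>"
    by auto
  have "x [^] (m * n) = \<one>" "y [^] (n * m) = \<one>"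
    using mn by (simp_all flip: nat_pow_pow)
  then have "(x \<otimes> y) [^] (m * n) = \<one>" "m * n > 0"
    using mn by (simp_all add: nat_pow_distrib mult.commute)
  then show "x \<otimes> y \<in> {x \<in> carrier G. \<exists>n::nat. n > 0 \<and> x [^] n = \<one>}"
    using mn by blast
qed auto

lemma torsion_free_quotient:
  defines "T \<equiv> {x \<in> carrier G. \<exists>n::nat. n > 0 \<and> x [^] n = \<one>}"
  shows "torsion_free_comm_group (G Mod T)"
proof -
  have T: "subgroup T G" unfolding T_def by (rule torsion_subgroup)
  interpret T: normal T G using T by (rule subgroup_imp_normal)
  interpret Q: comm_group "G Mod T" using T by (rule abelian_FactGroup)
  show ?thesis
  proof
    fix C and n :: nat
    assume "C \<in> carrier (G Mod T)" and n: "n > 0" and pow: "C [^]\<^bsub>G Mod T\<^esub> n = \<one>\<^bsub>G Mod T\<^esub>"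
    then obtain x where x: "x \<in> carrier G" "C = T #> x"
      by (auto simp: carrier_FactGroup)
    then have "T #> (x [^] n) = T"
      using pow by (simp add: T.FactGroup_pow)
    then have "x [^] n \<in> T"
      by (rule coset_join1) (use x T in auto)
    then obtain m :: nat where "m > 0" "(x [^] n) [^] m = \<one>"
      unfolding T_def by blast
    then have "x [^] (n * m) = \<one>" "n * m > 0"
      using x n by (auto simp: nat_pow_pow)
    then have "x \<in> T" using x unfolding T_def by blast
    then show "C = \<one>\<^bsub>G Mod T\<^esub>"
      using x T by (simp add: coset_join2)
  qed
qed

end

section \<open>Schur's theorem and finiteness of the subgroup of a tree\<close>

context group
begin

lemma power_in_products:
  assumes "S \<subseteq> carrier G" "x \<in> S"
  shows "x [^] n \<in> products S n"
proof (induction n)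
  case 0
  then show ?case by simp
next
  case (Suc n)
  have "x [^] n \<otimes> x \<in> products S (n + 1)"
    using Suc products_1[OF assms(1)] assms(2) by (intro products_mult[OF assms(1)]) auto
  then show ?case by simp
qed

text \<open>The generated subgroup acts on \<open>S\<close> by conjugation through a finite group, so it is finite
  modulo its center. If \<open>c = commutator a b\<close> has a central power \<open>c [^] Suc n\<close>, then
  \<open>c [^] Suc (Suc n) = conjugate a (c [^] n) \<otimes> commutator (a \<otimes> a) b\<close> saves one commutator.\<close>

lemma finite_derived_generate:
  assumes S: "symmetric_normal_set S" and "finite S"
  shows "finite (derived G (generate G S))"
proof -
  define W where "W = generate G S"
  have N: "W \<lhd> G" unfolding W_def using S by (rule generate_normal)
  interpret W: normal W G by (rule N)
  note cl = W.mem_carrier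
  note SD = symmetric_normal_setD[OF S]
  \<comment> \<open>Encodes the action by conjugation on \<open>S\<close>; restricting to
    \<open>S\<close> places these maps in a finite function space.\<close>
  define \<phi> where "\<phi> a = restrict (conjugate a) S" for a
  have "\<phi> ` W \<subseteq> S \<rightarrow>\<^sub>E S"
    using SD(5) cl by (auto simp: \<phi>_def)
  then have fin: "finite (\<phi> ` W)"
    using \<open>finite S\<close> finite_subset finite_PiE by metis
  \<comment> \<open>Conjugation is multiplicative and \<open>W\<close> consists of products of
    elements of \<open>S\<close>, so agreement on \<open>S\<close> extends to
    \<open>W\<close>.\<close>
  have conj_eq: "conjugate a b = conjugate a' b"
    if "\<phi> a = \<phi> a'" "a \<in> W" "a' \<in> W" "b \<in> W" for a a' b
  proof -
    have S_eq: "conjugate a v = conjugate a' v" if "v \<in> S" for v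
      using fun_cong[OF \<open>\<phi> a = \<phi> a'\<close>, of v] that by (simp add: \<phi>_def)
    obtain n where "b \<in> products S n"
      using \<open>b \<in> W\<close> by (auto simp: W_def generate_eq_Union_products[OF S])
    then show ?thesis
    proof (induction n arbitrary: b)
      case 0
      then show ?case using that cl by simp
    next
      case (Suc n)
      then obtain x y where b: "b = x \<otimes> y" "x \<in> S" "y \<in> products S n"
        by (auto simp: products_Suc)
      moreover from this have "x \<in> carrier G" "y \<in> carrier G"
        using SD(3) subsetD[OF products_subset[OF SD(1)]] by auto
      ultimately show ?case
        using that cl S_eq Suc.IH by (simp add: conjugate_mult)
    qed
  qed
  define C where "C = commutator_set W W"
  have C: "symmetric_normal_set C"
    unfolding C_def by (intro symmetric_normal_commutator_set normal_imp_symmetric_normal_set N)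
  note CD = symmetric_normal_setD[OF C]
  let ?r = "inv_into W \<phi>"
  \<comment> \<open>A commutator depends on its entries only through their actions: [a, b] = a^-1
    a^b settles the second entry, and inversion swaps the roles. Hence one representative for each
    action suffices.\<close>
  have "C \<subseteq> (\<lambda>(p, q). commutator (?r p) (?r q)) ` (\<phi> ` W \<times> \<phi> ` W)"
  proof
    fix c assume "c \<in> C"
    then obtain a b where ab: "a \<in> W" "b \<in> W" "c = commutator a b"
      by (auto simp: C_def commutator_set_def)
    define a' b' where "a' = ?r (\<phi> a)" and "b' = ?r (\<phi> b)"
    have a': "a' \<in> W" "\<phi> a' = \<phi> a" and b': "b' \<in> W" "\<phi> b' = \<phi> b"
      using ab by (auto simp: a'_def b'_def inv_into_into f_inv_into_f)
    have "commutator a b = commutator a b'"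
      using conj_eq[of b b' a] ab b' cl by (simp add: commutator_eq_inv_mult_conjugate)
    also have "\<dots> = inv (commutator b' a)"
      using ab b' cl by (simp add: inv_commutator)
    also have "commutator b' a = commutator b' a'"
      using conj_eq[of a a' b'] ab a' b' cl by (simp add: commutator_eq_inv_mult_conjugate)
    also have "inv \<dots> = commutator a' b'"
      using a' b' cl by (simp add: inv_commutator)
    finally show "c \<in> (\<lambda>(p, q). commutator (?r p) (?r q)) ` (\<phi> ` W \<times> \<phi> ` W)"
      using ab by (auto simp: a'_def b'_def)
  qed
  then have "finite C"
    using fin finite_subset by blast
  \<comment> \<open>Two different powers of \<open>w\<close> act alike because there are finitely
    many actions; cancelling the smaller power leaves a positive power that commutes with
    \<open>W\<close>.\<close>
  have central: "\<exists>n. \<forall>b\<in>W. conjugate b (w [^] Suc n) = w [^] Suc n" if w: "w \<in> W" for w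
  proof -
    have pw: "w [^] k \<in> W" for k :: nat
      using w by (induction k) auto
    have "\<not> inj (\<lambda>k::nat. \<phi> (w [^] k))"
    proof
      assume "inj (\<lambda>k::nat. \<phi> (w [^] k))"
      moreover have "range (\<lambda>k::nat. \<phi> (w [^] k)) \<subseteq> \<phi> ` W" using pw by auto
      ultimately show False
        using fin finite_subset finite_imageD infinite_UNIV_nat by blast
    qed
    then obtain i j :: nat where ij: "i < j" "\<phi> (w [^] i) = \<phi> (w [^] j)"
      unfolding inj_def by (metis nat_neq_iff)
    obtain n where n: "j = i + Suc n"
      using ij(1) less_iff_Suc_add by auto
    have "conjugate b (w [^] Suc n) = w [^] Suc n" if b: "b \<in> W" for b
    proof -
      have [simp]: "w \<in> carrier G" "b \<in> carrier G" using w b cl by auto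
      have "conjugate (w [^] i) b = conjugate (w [^] j) b"
        using ij(2) pw pw b by (rule conj_eq)
      also have "w [^] j = w [^] Suc n \<otimes> w [^] i"
        by (simp only: n nat_pow_mult \<open>w \<in> carrier G\<close> add.commute)
      also have "conjugate \<dots> b = conjugate (w [^] i) (conjugate (w [^] Suc n) b)"
        by (simp add: conjugate_def m_assoc inv_mult_group del: nat_pow_Suc)
      finally have "b = conjugate (w [^] Suc n) b"
        by (simp add: conjugate_def del: nat_pow_Suc)
      then have "w [^] Suc n \<otimes> b = b \<otimes> w [^] Suc n"
        by (metis \<open>w \<in> carrier G\<close> \<open>b \<in> carrier G\<close> conjugate_def inv_closed m_assoc
            m_closed mult_inv_cancel(1) nat_pow_closed)
      then show ?thesis
        by (simp add: conjugate_def m_assoc del: nat_pow_Suc)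
    qed
    then show ?thesis by blast
  qed
  have "finite (generate G C)"
  proof (rule finite_generate_of_short_powers[OF C \<open>finite C\<close>])
    fix c assume c: "c \<in> C"
    then obtain a b where ab: "a \<in> W" "b \<in> W" "c = commutator a b"
      by (auto simp: C_def commutator_set_def)
    then have [simp]: "a \<in> carrier G" "b \<in> carrier G" "c \<in> carrier G" using cl by auto
    have "c \<in> W" using ab normal_commutator_closed(1)[OF N] by auto
    then obtain n where n: "\<forall>b\<in>W. conjugate b (c [^] Suc n) = c [^] Suc n"
      using central by blast
    have "c [^] Suc (Suc n) = conjugate a (c [^] Suc n) \<otimes> c"
      using n ab by simp
    \<comment> \<open>One conjugated copy of \<open>c\<close> is split off and merged with the last
      factor, since [a, b]^a [a, b] = [aa, b].\<close>
    also have "\<dots> = conjugate a (c [^] n) \<otimes> commutator (a \<otimes> a) b"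
      by (simp add: conjugate_mult commutator_mult_left m_assoc flip: ab(3))
    also have "\<dots> \<in> products C (n + 1)"
    proof (rule products_mult[OF CD(1)])
      show "conjugate a (c [^] n) \<in> products C n"
        by (intro products_conjugate[OF C] power_in_products[OF CD(1) c]) simp
      have "commutator (a \<otimes> a) b \<in> C"
        using ab unfolding C_def commutator_set_def by blast
      then show "commutator (a \<otimes> a) b \<in> products C 1"
        unfolding products_1[OF CD(1)] .
    qed
    finally show "\<exists>p. c [^] Suc p \<in> products C p"
      by (intro exI[of _ "Suc n"]) simp
  qed
  moreover have "derived_set G W \<subseteq> C"
  proof -
    have "x \<otimes> y \<otimes> inv x \<otimes> inv y \<in> C" if "x \<in> W" "y \<in> W" for x y
    proof -
      \<comment> \<open>Passage from the convention of \<open>derived_set\<close> to that of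
        \<open>commutator\<close>.\<close>
      have "x \<otimes> y \<otimes> inv x \<otimes> inv y = commutator (inv x) (inv y)"
        using that cl by (simp add: commutator_def)
      then show ?thesis
        using that W.m_inv_closed unfolding C_def commutator_set_def by blast
    qed
    then show ?thesis by blast
  qed
  then have "derived G W \<subseteq> generate G C"
    unfolding derived_def by (rule mono_generate)
  ultimately show ?thesis
    unfolding W_def by (rule finite_subset[rotated])
qed

theorem finite_tree_subgroup:
  assumes t: "normal_leaves G t" and fin: "finite (tree_values t)"
  shows "finite (tree_subgroup t)"
proof -
  let ?W = "tree_subgroup t"
  let ?GW = "G\<lparr>carrier := ?W\<rparr>"
  define D where "D = derived G ?W"
  note V = symmetric_normal_tree_values[OF t]
  have W: "subgroup ?W G"
    using tree_subgroup_normal[OF t] by (rule normal_imp_subgroup)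
  interpret GW: group ?GW using W by (rule subgroup_imp_group)
  have "finite D"
    unfolding D_def tree_subgroup_def using V fin by (rule finite_derived_generate)
  interpret D: normal D ?GW
    unfolding D_def using W by (rule derived_subgroup_is_normal)
  have D: "subgroup D G"
    using D.subgroup_axioms W by (rule incl_subgroup[rotated])
  interpret Q: comm_group "?GW Mod D"
    unfolding D_def using W by (rule derived_quot_of_subgroup_is_comm_group)
  define T where "T = {x \<in> carrier (?GW Mod D). \<exists>n::nat. n > 0 \<and> x [^]\<^bsub>?GW Mod D\<^esub> n = \<one>\<^bsub>?GW Mod D\<^esub>}"
  have T: "subgroup T (?GW Mod D)"
    unfolding T_def by (rule Q.torsion_subgroup)
  interpret T: normal T "?GW Mod D" using T by (rule Q.subgroup_imp_normal)
  \<comment> \<open>The canonical map to the torsion-free quotient of the abelian group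
    \<open>?GW Mod D\<close>; its kernel consists of the elements with a positive power in
    \<open>D\<close>.\<close>
  define f where "f = (\<lambda>C. T #>\<^bsub>?GW Mod D\<^esub> C) \<circ> (\<lambda>x. D #>\<^bsub>?GW\<^esub> x)"
  have "f \<in> hom ?GW (?GW Mod D Mod T)"
    unfolding f_def by (rule Group.hom_compose[OF D.r_coset_hom_Mod T.r_coset_hom_Mod])
  \<comment> \<open>At the root the finiteness clause is immediate: finitely many values have
    finitely many products of each length.\<close>
  then have f: "bounded_hom (?GW Mod D Mod T) t f"
    using finite_products[OF fin] by (simp add: bounded_hom_def)
  have H: "torsion_free_comm_group (?GW Mod D Mod T)"
    unfolding T_def by (rule Q.torsion_free_quotient)
  have torsion: "\<exists>n. x [^] Suc n = \<one>" if x: "x \<in> ?W" for x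
  proof -
    have xG: "x \<in> carrier G" using t x by (rule tree_subgroup_closed)
    have xD: "D #>\<^bsub>?GW\<^esub> x \<in> carrier (?GW Mod D)"
      using x by (auto simp: carrier_FactGroup)
    have "f x = T"
      using bounded_hom_trivial[OF H t f x] by simp
    then have "D #>\<^bsub>?GW\<^esub> x \<in> T"
      using Q.coset_join1[OF _ xD T] by (simp add: f_def)
    then obtain n :: nat where n: "n > 0"
      "(D #>\<^bsub>?GW\<^esub> x) [^]\<^bsub>?GW Mod D\<^esub> n = \<one>\<^bsub>?GW Mod D\<^esub>"
      unfolding T_def by blast
    then have "D #>\<^bsub>?GW\<^esub> (x [^] n) = D"
      using D.FactGroup_pow[of x n] x unfolding nat_pow_consistent[of x n ?W] by simp
    moreover have "x [^] n \<in> ?W"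
      using GW.nat_pow_closed[of x n] x unfolding nat_pow_consistent[of x n ?W] by simp
    ultimately have "x [^] n \<in> D"
      using GW.coset_join1[OF _ _ D.subgroup_axioms] by simp
    \<comment> \<open>Torsion modulo \<open>D\<close> becomes genuine torsion because all powers of
      \<open>x [^] n\<close> stay in the finite group \<open>D\<close>.\<close>
    then have "(x [^] n) [^] k \<in> D" for k :: nat
      using subgroup.one_closed[OF D] subgroup.m_closed[OF D] by (induction k) auto
    then have "finite (range (\<lambda>k::nat. (x [^] n) [^] k))"
      by (intro finite_subset[OF _ \<open>finite D\<close>]) auto
    then obtain m :: nat where "m > 0" "(x [^] n) [^] m = \<one>"
      using finite_powers_imp_torsion[of "x [^] n"] xG by blast
    then have "x [^] (n * m) = \<one>" "n * m > 0"
      using xG n(1) by (auto simp: nat_pow_pow)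
    then show ?thesis using gr0_conv_Suc by metis
  qed
  show ?thesis
    unfolding tree_subgroup_def
  proof (rule finite_generate_of_short_powers[OF V fin])
    fix x assume "x \<in> tree_values t"
    then obtain n where "x [^] Suc n = \<one>"
      using torsion tree_values_subset by blast
    \<comment> \<open>The trivial power is the empty product, padded to \<open>n\<close>
      factors.\<close>
    moreover have "\<one> \<in> products (tree_values t) n"
      using products_mono[OF symmetric_normal_setD(1,2)[OF V], of 0 n] by simp
    ultimately show "\<exists>p. x [^] Suc p \<in> products (tree_values t) p"
      by (intro exI[of _ n]) simp
  qed
qed

end

section \<open>Lower central and derived words\<close>

lemma gword_eval_cong:
  "(\<And>i. i \<in> set_gword w \<Longrightarrow> g i = h i) \<Longrightarrow> gword_eval G g w = gword_eval G h w"
  by (induction w) auto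

lemma gword_eval_map: "gword_eval G g (map_gword f w) = gword_eval G (g \<circ> f) w"
  by (induction w) auto

lemma (in group) gword_eval_gcomm:
  "gword_eval G g (gcomm u v) = commutator (gword_eval G g u) (gword_eval G g v)"
  by (simp add: gcomm_def commutator_def)

text \<open>Shifting the variables of \<open>v\<close> beyond \<open>m\<close> makes the two sets of
  variables disjoint, so the entries of the commutator can be chosen independently.\<close>

lemma (in group) word_values_gcomm:
  assumes u: "set_gword u \<subseteq> {1..m}" and v: "set_gword v \<subseteq> {1..n}"
  shows "word_values G (m + n) (gcomm u (map_gword (\<lambda>i. m + i) v)) N =
    commutator_set (word_values G m u N) (word_values G n v (\<lambda>i. N (m + i)))"
proof (intro equalityI subsetI)
  fix c assume "c \<in> word_values G (m + n) (gcomm u (map_gword (\<lambda>i. m + i) v)) N"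
  then obtain g where g: "\<forall>i\<in>{1..m + n}. g i \<in> N i"
    and c: "c = commutator (gword_eval G g u) (gword_eval G (g \<circ> (\<lambda>i. m + i)) v)"
    by (auto simp: word_values_def gword_eval_gcomm gword_eval_map)
  have "gword_eval G g u \<in> word_values G m u N"
    using g by (auto simp: word_values_def)
  moreover have "gword_eval G (g \<circ> (\<lambda>i. m + i)) v \<in> word_values G n v (\<lambda>i. N (m + i))"
    unfolding word_values_def using g by (intro CollectI exI conjI refl) auto
  ultimately show "c \<in> commutator_set (word_values G m u N) (word_values G n v (\<lambda>i. N (m + i)))"
    using c by (auto simp: commutator_set_def)
next
  fix c assume "c \<in> commutator_set (word_values G m u N) (word_values G n v (\<lambda>i. N (m + i)))"
  then obtain g h where g: "\<forall>i\<in>{1..m}. g i \<in> N i" and h: "\<forall>i\<in>{1..n}. h i \<in> N (m + i)"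
    and c: "c = commutator (gword_eval G g u) (gword_eval G h v)"
    by (auto simp: commutator_set_def word_values_def)
  \<comment> \<open>Glues the two assignments, undoing the shift above \<open>m\<close>.\<close>
  define k where "k i = (if i \<le> m then g i else h (i - m))" for i
  have "gword_eval G k u = gword_eval G g u"
    using u by (intro gword_eval_cong) (auto simp: k_def)
  moreover have "gword_eval G (k \<circ> (\<lambda>i. m + i)) v = gword_eval G h v"
    using v by (intro gword_eval_cong) (auto simp: k_def)
  moreover have "\<forall>i\<in>{1..m + n}. k i \<in> N i"
  proof
    fix i assume i: "i \<in> {1..m + n}"
    show "k i \<in> N i"
    proof (cases "i \<le> m")
      case True
      then show ?thesis using g i by (simp add: k_def)
    next
      case False
      with i have "i - m \<in> {1..n}" by auto
      with h have "h (i - m) \<in> N (m + (i - m))" by blast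
      with False show ?thesis by (simp add: k_def)
    qed
  qed
  ultimately show "c \<in> word_values G (m + n) (gcomm u (map_gword (\<lambda>i. m + i) v)) N"
    unfolding word_values_def c
    by (intro CollectI exI[of _ k]) (simp add: gword_eval_gcomm gword_eval_map)
qed

lemma (in group) word_values_GVar: "word_values G 1 (GVar 1) N = N 1"
proof (intro equalityI subsetI)
  fix x assume "x \<in> N 1"
  then show "x \<in> word_values G 1 (GVar 1) N"
    unfolding word_values_def by (intro CollectI exI[of _ "\<lambda>_. x"]) simp
qed (auto simp: word_values_def)

lemma (in group) lower_central_word_values:
  assumes "\<And>i. i \<in> {1..Suc n} \<Longrightarrow> N i \<lhd> G"
  shows "\<exists>t. normal_leaves G t \<and> word_values G (Suc n) (lower_central_word (Suc n)) N = tree_values t"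
  using assms
proof (induction n)
  case 0
  then show ?case
    using word_values_GVar[of N] by (intro exI[of _ "Leaf (N 1)"]) simp
next
  case (Suc n)
  then obtain t where t: "normal_leaves G t"
    "word_values G (Suc n) (lower_central_word (Suc n)) N = tree_values t"
    by auto
  have "word_values G (Suc n + 1) (lower_central_word (Suc (Suc n))) N =
      commutator_set (tree_values t) (N (Suc n + 1))"
    \<comment> \<open>The new last variable is \<open>GVar 1\<close> shifted by
      \<open>Suc n\<close>, which puts the word in the form of the general lemma.\<close>
    using word_values_gcomm[of "lower_central_word (Suc n)" "Suc n" "GVar 1" 1 N]
      word_values_GVar[of "\<lambda>i. N (Suc n + i)"] t(2)
    by (simp add: set_lower_central_word)
  then show ?case
    using t(1) Suc.prems by (intro exI[of _ "Node t (Leaf (N (Suc n + 1)))"]) auto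
qed

lemma (in group) derived_word_values:
  assumes "\<And>i. i \<in> {1..2 ^ k} \<Longrightarrow> N i \<lhd> G"
  shows "\<exists>t. normal_leaves G t \<and> word_values G (2 ^ k) (derived_word k) N = tree_values t"
  using assms
\<comment> \<open>The tuple must vary because the right half of the word uses the entries shifted by
  \<open>2 ^ k\<close>.\<close>
proof (induction k arbitrary: N)
  case 0
  then show ?case
    using word_values_GVar[of N] by (intro exI[of _ "Leaf (N 1)"]) simp
next
  case (Suc k)
  obtain l where l: "normal_leaves G l" "word_values G (2 ^ k) (derived_word k) N = tree_values l"
    using Suc.IH[of N] Suc.prems by auto
  obtain r where r: "normal_leaves G r"
    "word_values G (2 ^ k) (derived_word k) (\<lambda>i. N (2 ^ k + i)) = tree_values r"
    using Suc.IH[of "\<lambda>i. N (2 ^ k + i)"] Suc.prems by auto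
  have "word_values G (2 ^ Suc k) (derived_word (Suc k)) N = tree_values (Node l r)"
    using word_values_gcomm[of "derived_word k" "2 ^ k" "derived_word k" "2 ^ k" N] l(2) r(2)
    by (simp add: set_derived_word mult_2)
  then show ?case
    using l(1) r(1) by (intro exI[of _ "Node l r"]) simp
qed

theorem theoremB:
  fixes G :: "('a, 'b) monoid_scheme" and N :: "nat \<Rightarrow> 'a set" and w :: "nat gword" and r :: nat
  assumes "group G"
    and "(r \<ge> 1 \<and> w = lower_central_word r) \<or> (\<exists>k. r = 2 ^ k \<and> w = derived_word k)"
    and "\<And>i. i \<in> {1..r} \<Longrightarrow> N i \<lhd> G"
    and "finite (word_values G r w N)"
  shows "finite (word_subgroup G r w N)"
proof -
  interpret group G by fact
  have "\<exists>t. normal_leaves G t \<and> word_values G r w N = tree_values t"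
    using assms(2)
  proof (elim disjE conjE exE)
    assume "r \<ge> 1" and w: "w = lower_central_word r"
    then obtain n where "r = Suc n" by (cases r) auto
    then show ?thesis
      using lower_central_word_values[of n N] assms(3) w by simp
  next
    fix k assume "r = 2 ^ k" "w = derived_word k"
    then show ?thesis
      using derived_word_values[of k N] assms(3) by simp
  qed
  then obtain t where "normal_leaves G t" "word_values G r w N = tree_values t"
    by blast
  then show ?thesis
    using finite_tree_subgroup[of t] assms(4) by (simp add: word_subgroup_def tree_subgroup_def)
qed

end
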